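(* Let $f_1,\dots,f_m\in\mathbb{R}[x]$ be $m\geq2$ polynomials such that $1,f_1,\dots,f_m$ are linearly independent over $\mathbb{R}$. Let $a_0=\max\{t\geq0: f_1(e^t)=\dots=f_m(e^t)=0\}$ (with $a_0=0$ if this set is empty), and fix $a>a_0$. Then there exists a constant $C>0$, depending only on $f_1,\dots,f_m$, such that for all $(\lambda_1,\dots,\lambda_m)\in\mathbb{R}^m$ and all $T>a$, $$-\frac{C}{T-a}\leq\widehat{\mu_T}(\lambda_1,\dots,\lambda_m)=\frac{1}{T-a}\int_a^T\cos\Big(2\pi\big(\lambda_1f_1(e^t)+\dots+\lambda_mf_m(e^t)\big)\Big)\,dt.$$
   Context: Here $\mu_T$ is the symmetric Borel probability measure on $\mathbb{R}^m$ given by $\mu_T(E)=\frac{1}{2(T-a)}\int_{e^a}^{e^T}\frac{\mathbf{1}_E(F(s))+\mathbf{1}_{-E}(F(s))}{s}\,ds$ with $F(s)=(f_1(s),\dots,f_m(s))$, and $\widehat{\mu_T}(\lambda)=\int e^{-2\pi i x\cdot\lambda}\,d\mu_T(x)$, which equals the displayed integral. *)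

theory Defs
  imports "HOL-Probability.Probability" "HOL-Computational_Algebra.Polynomial"
begin

section \<open>The polynomial curve\<close>

definition poly_curve :: "('m::finite \<Rightarrow> real poly) \<Rightarrow> real \<Rightarrow> real ^ 'm" where
  "poly_curve f s = (\<chi> i. poly (f i) s)"

text \<open>Linear independence over the reals of \<open>1, f\<^sub>1, \<dots>, f\<^sub>m\<close> as an indexed family, indexed by
  \<open>'m option\<close> with \<open>None\<close> for the constant polynomial; injectivity excludes repeated members, which
  the set-based library notion does not see. Since \<^typ>\<open>real poly\<close> is not an instance of the
  library's class of real vector spaces, the locale constant is applied to \<open>smult\<close>.\<close>

definition one_and_lin_indep :: "('m::finite \<Rightarrow> real poly) \<Rightarrow> bool" where
  "one_and_lin_indep f \<longleftrightarrow>
     inj (case_option 1 f) \<and> \<not> module.dependent smult (range (case_option 1 f))"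

lemma vector_space_poly: "vector_space (smult :: real \<Rightarrow> real poly \<Rightarrow> real poly)"
  by unfold_locales (simp_all add: smult_add_right smult_add_left)

lemma one_and_lin_indep_iff:
  "one_and_lin_indep f \<longleftrightarrow>
     (\<forall>c0 c. smult c0 1 + (\<Sum>i\<in>UNIV. smult (c i) (f i)) = 0 \<longrightarrow> c0 = 0 \<and> (\<forall>i. c i = 0))"
    (is "?L = ?R")
proof -
  interpret V: vector_space "smult :: real \<Rightarrow> real poly \<Rightarrow> real poly"
    by (rule vector_space_poly)
  define v where "v = case_option (1 :: real poly) f"
  have split: "(\<Sum>j\<in>UNIV. smult (b j) (v j)) =
      smult (b None) 1 + (\<Sum>i\<in>UNIV. smult (b (Some i)) (f i))" for b
    by (simp add: v_def UNIV_option_conv sum.reindex)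
  show ?thesis
  proof
    assume L: ?L
    then have inj: "inj v" and ind: "\<not> V.dependent (range v)"
      by (auto simp: one_and_lin_indep_def v_def)
    show ?R
    proof (intro allI impI)
      fix c0 c assume eq: "smult c0 1 + (\<Sum>i\<in>UNIV. smult (c i) (f i)) = 0"
      define u where "u = (\<lambda>p. case_option c0 c (inv v p))"
      have "(\<Sum>p\<in>range v. smult (u p) p) = (\<Sum>j\<in>UNIV. smult (case_option c0 c j) (v j))"
        using inj by (simp add: sum.reindex u_def)
      also have "\<dots> = 0" using eq by (simp add: split)
      finally have "\<forall>p\<in>range v. u p = 0"
        using ind by (auto simp: V.dependent_finite)
      then have "case_option c0 c j = 0" for j
        using inj by (auto simp: u_def)
      from this[of None] this[of "Some _"] show "c0 = 0 \<and> (\<forall>i. c i = 0)" by simp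
    qed
  next
    assume R: ?R
    have R': "b j = 0" if "(\<Sum>j\<in>UNIV. smult (b j) (v j)) = 0" for b j
      using R[rule_format, of "b None" "\<lambda>i. b (Some i)"] that by (cases j) (auto simp: split)
    have inj: "inj v"
    proof (rule injI, rule ccontr)
      fix j k assume jk: "v j = v k" "j \<noteq> k"
      define b where "b = (\<lambda>l. if l = j then 1 else if l = k then -1 else (0::real))"
      have "(\<Sum>l\<in>UNIV. smult (b l) (v l)) = (\<Sum>l\<in>{j,k}. smult (b l) (v l))"
        by (rule sum.mono_neutral_right) (auto simp: b_def)
      also have "\<dots> = 0" using jk by (simp add: b_def)
      finally show False using R'[of b j] by (simp add: b_def)
    qed
    have "\<not> V.dependent (range v)"
    proof
      assume "V.dependent (range v)"
      then obtain u p where u: "p \<in> range v" "u p \<noteq> 0" "(\<Sum>p\<in>range v. smult (u p) p) = 0"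
        by (auto simp: V.dependent_finite)
      then have "(\<Sum>j\<in>UNIV. smult (u (v j)) (v j)) = 0"
        using inj by (simp add: sum.reindex)
      from R'[OF this] u show False by auto
    qed
    with inj show ?L by (simp add: one_and_lin_indep_def v_def)
  qed
qed

definition common_log_zeros :: "('m::finite \<Rightarrow> real poly) \<Rightarrow> real set" where
  "common_log_zeros f = {t. t \<ge> 0 \<and> (\<forall>i. poly (f i) (exp t) = 0)}"

definition last_log_zero :: "('m::finite \<Rightarrow> real poly) \<Rightarrow> real" where
  "last_log_zero f = (if common_log_zeros f = {} then 0 else Max (common_log_zeros f))"

lemma finite_common_log_zeros:
  assumes "one_and_lin_indep f"
  shows "finite (common_log_zeros f)"
proof -
  fix i
  have "f i \<noteq> 0"
  proof
    assume "f i = 0"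
    then have "smult 0 1 + (\<Sum>j\<in>UNIV. smult (if j = i then 1 else 0) (f j)) = 0"
      by (auto intro!: sum.neutral)
    from assms[unfolded one_and_lin_indep_iff, rule_format, OF this]
    have "\<forall>j. (if j = i then 1 else 0 :: real) = 0" by (rule conjunct2)
    then show False by (auto dest: spec[of _ i])
  qed
  then have "finite (exp -` {x. poly (f i) x = 0})"
    by (intro finite_vimageI poly_roots_finite) (auto simp: inj_on_def)
  then show ?thesis
    by (rule finite_subset[rotated]) (auto simp: common_log_zeros_def)
qed

section \<open>The symmetric measure along a curve and its Fourier transform\<close>

definition curve_measure :: "(real \<Rightarrow> real ^ 'm::finite) \<Rightarrow> real \<Rightarrow> real \<Rightarrow> (real ^ 'm) measure" where
  "curve_measure F a T = measure_of UNIV (sets borel)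
     (\<lambda>E. ennreal (1 / (2 * (T - a))) *
       (\<integral>\<^sup>+s\<in>{exp a..exp T}. ennreal ((indicator E (F s) + indicator (uminus ` E) (F s)) / s) \<partial>lborel))"

definition fourier_transform :: "('a::euclidean_space) measure \<Rightarrow> 'a \<Rightarrow> complex" where
  "fourier_transform M l = (LINT x|M. exp (- 2 * of_real pi * \<i> * of_real (x \<bullet> l)))"

text \<open>\<open>measure_of\<close> yields a null measure when its argument is not countably additive; the following
  facts show that this does not happen here.\<close>

lemma space_curve_measure [simp]: "space (curve_measure F a T) = UNIV"
  by (simp add: curve_measure_def space_measure_of_conv)

lemma sets_curve_measure [simp, measurable_cong]: "sets (curve_measure F a T) = sets borel"
  using sets.sigma_sets_eq[of "borel :: (real ^ 'a) measure"]
  by (simp add: curve_measure_def sets_measure_of_conv)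

lemma curve_measure_integrand_split:
  fixes F :: "real \<Rightarrow> real ^ 'm::finite" and a T :: real
  assumes F [measurable]: "F \<in> borel_measurable borel" and E [measurable]: "E \<in> sets borel"
  defines "N \<equiv> density lborel (\<lambda>s. ennreal (1 / s) * indicator {exp a..exp T} s)"
  shows "(\<integral>\<^sup>+s\<in>{exp a..exp T}. ennreal ((indicator E (F s) + indicator (uminus ` E) (F s)) / s) \<partial>lborel)
    = emeasure (distr N borel F) E + emeasure (distr N borel (\<lambda>s. - F s)) E"
proof -
  have *: "emeasure (distr N borel G) E =
      (\<integral>\<^sup>+s. ennreal (1 / s) * indicator {exp a..exp T} s * indicator E (G s) \<partial>lborel)"
    if [measurable]: "G \<in> borel_measurable borel" for G
  proof -
    have "emeasure (distr N borel G) E = emeasure N (G -` E)"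
      by (simp add: N_def emeasure_distr)
    also have "\<dots> = (\<integral>\<^sup>+s. ennreal (1 / s) * indicator {exp a..exp T} s * indicator (G -` E) s \<partial>lborel)"
      using measurable_sets[OF that E] by (simp add: N_def emeasure_density)
    finally show ?thesis by (simp add: indicator_def vimage_def)
  qed
  have neg: "x \<in> uminus ` E \<longleftrightarrow> - x \<in> E" for x :: "real ^ 'm"
    by (metis image_iff minus_minus)
  have "(\<integral>\<^sup>+s\<in>{exp a..exp T}. ennreal ((indicator E (F s) + indicator (uminus ` E) (F s)) / s) \<partial>lborel)
    = (\<integral>\<^sup>+s. ennreal (1 / s) * indicator {exp a..exp T} s * indicator E (F s)
         + ennreal (1 / s) * indicator {exp a..exp T} s * indicator E (- F s) \<partial>lborel)"
  proof (rule nn_integral_cong)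
    fix s :: real
    have "s > 0" if "exp a \<le> s" using that exp_gt_zero[of a] by linarith
    then show "ennreal ((indicator E (F s) + indicator (uminus ` E) (F s)) / s) * indicator {exp a..exp T} s
      = ennreal (1 / s) * indicator {exp a..exp T} s * indicator E (F s)
         + ennreal (1 / s) * indicator {exp a..exp T} s * indicator E (- F s)"
      by (auto simp: indicator_def neg simp flip: ennreal_plus)
  qed
  also have "\<dots> = emeasure (distr N borel F) E + emeasure (distr N borel (\<lambda>s. - F s)) E"
    by (subst nn_integral_add) (simp_all add: *)
  finally show ?thesis .
qed

lemma emeasure_curve_measure:
  fixes F :: "real \<Rightarrow> real ^ 'm::finite"
  assumes F [measurable]: "F \<in> borel_measurable borel" and E: "E \<in> sets borel"
  shows "emeasure (curve_measure F a T) E = ennreal (1 / (2 * (T - a))) *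
       (\<integral>\<^sup>+s\<in>{exp a..exp T}. ennreal ((indicator E (F s) + indicator (uminus ` E) (F s)) / s) \<partial>lborel)"
    (is "_ = ?\<mu> E")
  unfolding curve_measure_def
proof (rule emeasure_measure_of_sigma[OF _ _ _ E])
  define N where "N = density lborel (\<lambda>s. ennreal (1 / s) * indicator {exp a..exp T} s)"
  have eq: "?\<mu> E = ennreal (1 / (2 * (T - a))) *
      (emeasure (distr N borel F) E + emeasure (distr N borel (\<lambda>s. - F s)) E)"
    if "E \<in> sets borel" for E
    using curve_measure_integrand_split[OF F that] by (simp add: N_def)
  show "sigma_algebra UNIV (sets (borel :: (real ^ 'm) measure))"
    by (metis sets.sigma_algebra_axioms space_borel)
  show "positive (sets borel) ?\<mu>"
    by (simp add: positive_def)
  show "countably_additive (sets borel) ?\<mu>"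
  proof (rule countably_additiveI)
    fix A :: "nat \<Rightarrow> (real ^ 'm) set"
    assume A: "range A \<subseteq> sets borel" "disjoint_family A" "(\<Union>i. A i) \<in> sets borel"
    have "(\<Sum>i. ?\<mu> (A i)) = (\<Sum>i. ennreal (1 / (2 * (T - a))) *
      (emeasure (distr N borel F) (A i) + emeasure (distr N borel (\<lambda>s. - F s)) (A i)))"
      using A(1) by (intro suminf_cong eq) auto
    also have "\<dots> = ennreal (1 / (2 * (T - a))) *
      ((\<Sum>i. emeasure (distr N borel F) (A i)) + (\<Sum>i. emeasure (distr N borel (\<lambda>s. - F s)) (A i)))"
      by (subst suminf_add) (auto simp: ennreal_suminf_cmult)
    also have "\<dots> = ennreal (1 / (2 * (T - a))) *
      (emeasure (distr N borel F) (\<Union>i. A i) + emeasure (distr N borel (\<lambda>s. - F s)) (\<Union>i. A i))"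
      using A by (simp add: suminf_emeasure)
    also have "\<dots> = ?\<mu> (\<Union>i. A i)" by (rule eq[OF A(3), symmetric])
    finally show "(\<Sum>i. ?\<mu> (A i)) = ?\<mu> (\<Union>i. A i)" .
  qed
qed

lemma prob_space_curve_measure:
  fixes F :: "real \<Rightarrow> real ^ 'm::finite"
  assumes F: "F \<in> borel_measurable borel" and aT: "a < T"
  shows "prob_space (curve_measure F a T)"
proof (rule prob_spaceI)
  have surj: "range (uminus :: real ^ 'm \<Rightarrow> _) = UNIV" by (metis surj_def minus_minus)
  have "(\<integral>\<^sup>+s. ennreal (2 / s) * indicator {exp a..exp T} s \<partial>lborel)
      = ennreal (2 * ln (exp T) - 2 * ln (exp a))"
  proof (rule nn_integral_FTC_Icc[where F = "\<lambda>x. 2 * ln x"])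
    fix x assume "x \<in> {exp a..exp T}"
    then have "x > 0" using less_le_trans[OF exp_gt_zero[of a]] by auto
    then show "0 \<le> 2 / x" by simp
    show "((\<lambda>x. 2 * ln x) has_real_derivative 2 / x) (at x)"
      using \<open>x > 0\<close> by (auto intro!: derivative_eq_intros)
  qed (use aT in auto)
  then show "emeasure (curve_measure F a T) (space (curve_measure F a T)) = 1"
    using aT by (simp add: emeasure_curve_measure[OF F] surj ennreal_mult[symmetric])
qed

lemma poly_curve_measurable: "poly_curve f \<in> borel_measurable borel"
  unfolding poly_curve_def
  by (intro borel_measurable_continuous_onI continuous_intros)

end

theory Submission
  imports Defs
begin

text \<open>
  In the variable \<open>t\<close> the phase is \<open>\<theta> + g t\<close> with \<open>g t = (\<Sum>k=1..d. b k * exp (k t))\<close>. By linear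
  independence of \<open>1, f\<^sub>1, \<dots>, f\<^sub>m\<close> the frequency \<open>\<lambda>\<close>, and hence the constant term, is controlled by the
  \<open>b k\<close>: \<open>\<bar>\<theta>\<bar> \<le> K * (\<Sum>k. \<bar>b k\<bar>)\<close>. Put \<open>B t = (\<Sum>k=1..d. \<bar>b k\<bar> * exp (k t))\<close>, which grows at least like
  \<open>exp t\<close>. As long as \<open>B\<close> is small, the phase is at most \<open>\<pi> / 2\<close> and the cosine is nonnegative; this
  is where \<open>t \<ge> 0\<close> is used. Once \<open>B \<ge> \<delta>\<close>, the integral of the cosine is bounded: away from the at most
  \<open>d\<^sup>2\<close> points where two terms of \<open>B\<close> have equal size, a single term dominates, so that
  \<open>\<bar>g'\<bar> \<ge> \<kappa> B\<close>, and one integration by parts leaves an integrand of size \<open>1 / B\<close>, which decays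
  exponentially. The excluded neighbourhoods have bounded total length.
\<close>

section \<open>Oscillatory integrals of exponential sums\<close>

text \<open>A real polynomial of degree at most \<open>d\<close> without constant term, evaluated at
  \<open>exp t\<close>. The constant term is kept apart as \<open>\<theta>\<close>: it does not grow
  with \<open>t\<close> and vanishes on differentiation.\<close>

definition exp_sum :: "nat \<Rightarrow> (nat \<Rightarrow> real) \<Rightarrow> real \<Rightarrow> real" where
  "exp_sum d b t = (\<Sum>k=1..d. b k * exp (real k * t))"

lemma exp_sum_has_real_derivative [derivative_intros]:
  "(exp_sum d b has_real_derivative exp_sum d (\<lambda>k. real k * b k) t) (at t within S)"
  unfolding exp_sum_def
  by (auto intro!: derivative_eq_intros sum.cong)

lemma continuous_on_exp_sum [continuous_intros]: "continuous_on S (exp_sum d b)"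
  unfolding exp_sum_def by (intro continuous_intros)

text \<open>Termwise comparison with the majorant \<open>B\<close>; it serves with
  \<open>M = 1\<close> for the phase and with \<open>M = (real d)\<^sup>2\<close> for its second
  derivative.\<close>

lemma abs_exp_sum_le:
  assumes "\<And>k. k \<in> {1..d} \<Longrightarrow> \<bar>b k\<bar> \<le> M * \<bar>c k\<bar>"
  shows "\<bar>exp_sum d b t\<bar> \<le> M * exp_sum d (\<lambda>k. \<bar>c k\<bar>) t"
proof -
  have "\<bar>exp_sum d b t\<bar> \<le> (\<Sum>k=1..d. \<bar>b k * exp (real k * t)\<bar>)"
    unfolding exp_sum_def by (rule sum_abs)
  also have "\<dots> \<le> (\<Sum>k=1..d. (M * \<bar>c k\<bar>) * exp (real k * t))"
    using assms by (intro sum_mono) (auto simp: abs_mult)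
  finally show ?thesis by (simp add: exp_sum_def sum_distrib_left mult.assoc)
qed

text \<open>The lowest frequency is 1, so every single term gains at least the factor
  \<open>exp (t - u)\<close>.\<close>

lemma exp_sum_growth:
  assumes "\<And>k. b k \<ge> 0" "u \<le> t"
  shows "exp (t - u) * exp_sum d b u \<le> exp_sum d b t"
  unfolding exp_sum_def sum_distrib_left
proof (rule sum_mono)
  fix k assume k: "k \<in> {1..d}"
  have "1 * (t - u) \<le> real k * (t - u)"
    using k assms(2) by (intro mult_right_mono) auto
  then have "t - u + real k * u \<le> real k * t"
    by (simp add: algebra_simps)
  then have "b k * exp (t - u + real k * u) \<le> b k * exp (real k * t)"
    using assms(1) by (intro mult_left_mono) auto
  then show "exp (t - u) * (b k * exp (real k * u)) \<le> b k * exp (real k * t)"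
    by (simp add: exp_add mult_ac)
qed

lemma exp_sum_mono:
  assumes "\<And>k. b k \<ge> 0" "u \<le> t"
  shows "exp_sum d b u \<le> exp_sum d b t"
proof -
  have "exp_sum d b u \<ge> 0"
    using assms(1) by (auto simp: exp_sum_def intro!: sum_nonneg)
  then have "1 * exp_sum d b u \<le> exp (t - u) * exp_sum d b u"
    using assms(2) by (intro mult_right_mono) auto
  also have "\<dots> \<le> exp_sum d b t"
    using assms by (rule exp_sum_growth)
  finally show ?thesis by simp
qed

section \<open>Two-sided bounds where the phase oscillates\<close>

text \<open>Integration by parts against the derivative \<open>D\<close> of the phase. The two
  boundary terms are at most \<open>1 / (\<kappa> * \<delta>)\<close> each. The remaining integrand
  is of size \<open>1 / B t\<close>, which decays like \<open>exp (u - t)\<close>, so the bound does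
  not depend on the length of the interval.\<close>

lemma integral_cos_exp_sum_le:
  assumes uv: "u \<le> v" and "\<delta> > 0" "\<kappa> > 0"
    and lower: "\<And>t. t \<in> {u..v} \<Longrightarrow>
      \<kappa> * exp_sum d (\<lambda>k. \<bar>b k\<bar>) t \<le> \<bar>exp_sum d (\<lambda>k. real k * b k) t\<bar>"
    and start: "\<delta> \<le> exp_sum d (\<lambda>k. \<bar>b k\<bar>) u"
  shows "\<bar>integral {u..v} (\<lambda>t. cos (\<theta> + exp_sum d b t))\<bar>
    \<le> 2 / (\<kappa> * \<delta>) + (real d)\<^sup>2 / (\<kappa>\<^sup>2 * \<delta>)"
proof -
  define B where "B = exp_sum d (\<lambda>k. \<bar>b k\<bar>)"
  define D where "D = exp_sum d (\<lambda>k. real k * b k)"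
  define E where "E = exp_sum d (\<lambda>k. real k * (real k * b k))"
  define \<phi> where "\<phi> t = \<theta> + exp_sum d b t" for t
  define G where "G t = sin (\<phi> t) / D t" for t
  have B: "\<delta> * exp (t - u) \<le> B t" if "t \<in> {u..v}" for t
  proof -
    have "\<delta> * exp (t - u) \<le> B u * exp (t - u)"
      using start by (intro mult_right_mono) (auto simp: B_def)
    also have "\<dots> \<le> B t"
      using exp_sum_growth[of "\<lambda>k. \<bar>b k\<bar>" u t d] that by (simp add: B_def mult.commute)
    finally show ?thesis .
  qed
  have B_pos: "B t > 0" if "t \<in> {u..v}" for t
    using B[OF that] \<open>\<delta> > 0\<close> by (smt (verit) exp_gt_zero mult_pos_pos)
  have B_ge: "\<delta> \<le> B t" if "t \<in> {u..v}" for t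
  proof -
    have "\<delta> * 1 \<le> \<delta> * exp (t - u)"
      using that \<open>\<delta> > 0\<close> by (intro mult_left_mono) auto
    with B[OF that] show ?thesis by simp
  qed
  have D: "\<kappa> * B t \<le> \<bar>D t\<bar>" if "t \<in> {u..v}" for t
    using lower[OF that] by (simp add: B_def D_def)
  have D_nz: "D t \<noteq> 0" if "t \<in> {u..v}" for t
    using D[OF that] B_pos[OF that] \<open>\<kappa> > 0\<close> by (smt (verit) mult_pos_pos)
  have E: "\<bar>E t\<bar> \<le> (real d)\<^sup>2 * B t" for t
    unfolding E_def B_def
  proof (rule abs_exp_sum_le)
    fix k assume "k \<in> {1..d}"
    then have "real k * real k \<le> (real d)\<^sup>2"
      by (simp add: power2_eq_square mult_mono)
    then show "\<bar>real k * (real k * b k)\<bar> \<le> (real d)\<^sup>2 * \<bar>b k\<bar>"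
      by (simp add: abs_mult mult_right_mono flip: mult.assoc)
  qed
  have \<phi>': "(\<phi> has_real_derivative D t) (at t within S)" for t S
    unfolding \<phi>_def D_def by (auto intro!: derivative_eq_intros)
  have D': "(D has_real_derivative E t) (at t within S)" for t S
    unfolding D_def E_def by (auto intro!: derivative_eq_intros)
  have cont: "continuous_on S \<phi>" "continuous_on S D" "continuous_on S E" for S
    unfolding \<phi>_def D_def E_def by (intro continuous_intros)+
  \<comment> \<open>Since \<open>D\<close> and \<open>E\<close> are the first two derivatives of the
    phase, the quotient rule for \<open>sin (\<phi> t) / D t\<close> gives the cosine minus the term
    with \<open>E\<close>.\<close>
  have FTC: "((\<lambda>t. cos (\<phi> t) - sin (\<phi> t) * E t / (D t)\<^sup>2) has_integral G v - G u) {u..v}"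
  proof (rule fundamental_theorem_of_calculus[OF uv])
    fix t assume t: "t \<in> {u..v}"
    have "(G has_real_derivative cos (\<phi> t) - sin (\<phi> t) * E t / (D t)\<^sup>2) (at t within {u..v})"
      unfolding G_def using D_nz[OF t]
      by (auto intro!: derivative_eq_intros \<phi>' D' simp: field_simps power2_eq_square)
    then show "(G has_vector_derivative cos (\<phi> t) - sin (\<phi> t) * E t / (D t)\<^sup>2) (at t within {u..v})"
      by (simp add: has_real_derivative_iff_has_vector_derivative)
  qed
  have int1: "(\<lambda>t. cos (\<phi> t)) integrable_on {u..v}"
    by (intro integrable_continuous_interval continuous_intros cont)
  have int2: "(\<lambda>t. sin (\<phi> t) * E t / (D t)\<^sup>2) integrable_on {u..v}"
    using D_nz by (intro integrable_continuous_interval continuous_intros cont) auto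
  have eq: "integral {u..v} (\<lambda>t. cos (\<phi> t)) =
      G v - G u + integral {u..v} (\<lambda>t. sin (\<phi> t) * E t / (D t)\<^sup>2)"
    using integral_unique[OF FTC] integral_diff[OF int1 int2] by simp
  have G: "\<bar>G t\<bar> \<le> 1 / (\<kappa> * \<delta>)" if t: "t \<in> {u..v}" for t
  proof -
    have "\<kappa> * \<delta> \<le> \<kappa> * B t"
      using B_ge[OF t] \<open>\<kappa> > 0\<close> by (intro mult_left_mono) auto
    with D[OF t] have "\<kappa> * \<delta> \<le> \<bar>D t\<bar>" by simp
    then show ?thesis
      unfolding G_def abs_divide using \<open>\<kappa> > 0\<close> \<open>\<delta> > 0\<close> by (intro frac_le) auto
  qed
  \<comment> \<open>\<open>c\<close> is the bound for the remaining integrand at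
    \<open>t = u\<close>, and also bounds the integral of \<open>c * exp (u - t)\<close>.\<close>
  define c where "c = (real d)\<^sup>2 / (\<kappa>\<^sup>2 * \<delta>)"
  have c: "c \<ge> 0"
    using \<open>\<delta> > 0\<close> by (simp add: c_def)
  have "((\<lambda>t. c * exp (u - t)) has_integral - c * exp (u - v) - - c * exp (u - u)) {u..v}"
    by (rule fundamental_theorem_of_calculus[OF uv])
       (auto intro!: derivative_eq_intros simp flip: has_real_derivative_iff_has_vector_derivative)
  then have tail: "((\<lambda>t. c * exp (u - t)) has_integral c - c * exp (u - v)) {u..v}"
    by simp
  have "norm (integral {u..v} (\<lambda>t. sin (\<phi> t) * E t / (D t)\<^sup>2)) \<le> integral {u..v} (\<lambda>t. c * exp (u - t))"
  proof (rule integral_norm_bound_integral[OF int2])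
    show "(\<lambda>t. c * exp (u - t)) integrable_on {u..v}"
      using tail by blast
    fix t assume t: "t \<in> {u..v}"
    have "(\<kappa> * B t)\<^sup>2 \<le> \<bar>D t\<bar>\<^sup>2"
      using D[OF t] B_pos[OF t] \<open>\<kappa> > 0\<close> by (intro power_mono) auto
    moreover have "\<bar>sin (\<phi> t)\<bar> * \<bar>E t\<bar> \<le> 1 * ((real d)\<^sup>2 * B t)"
      by (intro mult_mono E) auto
    \<comment> \<open>\<open>E\<close> costs one factor \<open>B t\<close> and \<open>D\<close>
      squared gains two, so one factor survives in the denominator.\<close>
    ultimately have "\<bar>sin (\<phi> t)\<bar> * \<bar>E t\<bar> / \<bar>D t\<bar>\<^sup>2 \<le> ((real d)\<^sup>2 * B t) / (\<kappa> * B t)\<^sup>2"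
      using B_pos[OF t] \<open>\<kappa> > 0\<close> by (intro frac_le) auto
    also have "\<dots> = (real d)\<^sup>2 / (\<kappa>\<^sup>2 * B t)"
      using B_pos[OF t] by (simp add: power2_eq_square)
    also have "\<dots> \<le> (real d)\<^sup>2 / (\<kappa>\<^sup>2 * (\<delta> * exp (t - u)))"
      using B[OF t] B_pos[OF t] \<open>\<delta> > 0\<close> \<open>\<kappa> > 0\<close> by (intro divide_left_mono mult_left_mono) auto
    also have "\<dots> = c * exp (u - t)"
      by (simp add: c_def exp_diff field_simps)
    finally show "norm (sin (\<phi> t) * E t / (D t)\<^sup>2) \<le> c * exp (u - t)"
      by (simp add: abs_mult)
  qed
  also have "\<dots> = c - c * exp (u - v)"
    using tail by (rule integral_unique)
  also have "\<dots> \<le> c"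
    using c by simp
  finally have "\<bar>integral {u..v} (\<lambda>t. cos (\<phi> t))\<bar> \<le> 2 / (\<kappa> * \<delta>) + c"
    using eq G[of u] G[of v] uv by (simp add: field_simps)
  then show ?thesis by (simp add: \<phi>_def c_def)
qed

text \<open>The quotient in \<open>far\<close> is the point where the terms \<open>j\<close> and
  \<open>k\<close> have equal size. The logarithm of their ratio is affine in \<open>t\<close> with
  slope of modulus at least 1, so at distance \<open>R\<close> from that point the smaller term is
  at most \<open>exp (- R)\<close> times the larger. The choice of \<open>R\<close> makes all other
  terms of the derivative together at most half of the largest one.\<close>

lemma exp_sum_dominant:
  assumes R: "2 * (real d)\<^sup>2 \<le> exp R" and "d > 0"
    and far: "\<And>j k. j \<in> {1..d} \<Longrightarrow> k \<in> {1..d} \<Longrightarrow>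
      R \<le> \<bar>t - (ln \<bar>b j\<bar> - ln \<bar>b k\<bar>) / (real k - real j)\<bar>"
  shows "1 / (2 * real d) * exp_sum d (\<lambda>k. \<bar>b k\<bar>) t \<le> \<bar>exp_sum d (\<lambda>k. real k * b k) t\<bar>"
proof -
  define m where "m k = \<bar>b k\<bar> * exp (real k * t)" for k
  have m0: "m k \<ge> 0" for k by (simp add: m_def)
  have R0: "R \<ge> 0"
  proof -
    have "1 \<le> (real d)\<^sup>2" using \<open>d > 0\<close> by (simp add: one_le_power)
    then have "exp 0 \<le> exp R" using R unfolding exp_zero by linarith
    then show ?thesis by simp
  qed
  obtain j where j: "j \<in> {1..d}" and max: "\<And>k. k \<in> {1..d} \<Longrightarrow> m k \<le> m j"
  proof -
    have ne: "m ` {1..d} \<noteq> {}" using \<open>d > 0\<close> by simp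
    have "Max (m ` {1..d}) \<in> m ` {1..d}" using ne by (intro Max_in) auto
    then obtain j where "j \<in> {1..d}" "m j = Max (m ` {1..d})" by auto
    then show ?thesis by (intro that[of j]) auto
  qed
  have small: "m k \<le> exp (- R) * m j" if k: "k \<in> {1..d}" "k \<noteq> j" for k
  proof (cases "m k = 0")
    case True
    then show ?thesis using m0 by simp
  next
    case False
    then have nz: "b k \<noteq> 0" by (auto simp: m_def)
    have "m j > 0" using max[OF k(1)] False m0[of k] by linarith
    then have nzj: "b j \<noteq> 0" by (auto simp: m_def)
    \<comment> \<open>\<open>z\<close> is the zero of the affine function
      \<open>ln (m k) - ln (m j)\<close> of \<open>t\<close>.\<close>
    define z where "z = (ln \<bar>b j\<bar> - ln \<bar>b k\<bar>) / (real k - real j)"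
    have ln_m: "ln (m i) = ln \<bar>b i\<bar> + real i * t" if "b i \<noteq> 0" for i
      using that by (simp add: m_def ln_mult)
    have kj: "real k - real j \<noteq> 0" using k by simp
    have "(real k - real j) * z = ln \<bar>b j\<bar> - ln \<bar>b k\<bar>"
      using kj by (simp add: z_def)
    then have "ln (m k) - ln (m j) = (real k - real j) * (t - z)"
      unfolding ln_m[OF nz] ln_m[OF nzj] by (simp add: algebra_simps)
    then have "\<bar>ln (m k) - ln (m j)\<bar> = \<bar>real k - real j\<bar> * \<bar>t - z\<bar>"
      by (simp add: abs_mult)
    \<comment> \<open>Distinct integers \<open>k\<close> and \<open>j\<close> differ by at least
      1.\<close>
    also have "\<dots> \<ge> 1 * R"
      using k(2) far[OF j k(1)] R0 by (intro mult_mono) (auto simp: z_def)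
    finally have "R \<le> \<bar>ln (m k) - ln (m j)\<bar>" by simp
    moreover have "m k > 0" using False m0[of k] by simp
    then have "ln (m k) \<le> ln (m j)"
      using max[OF k(1)] by simp
    ultimately have "ln (m k) \<le> - R + ln (m j)" by simp
    then have "ln (m k) \<le> ln (exp (- R) * m j)"
      using \<open>m j > 0\<close> by (simp add: ln_mult)
    then show ?thesis
      using \<open>m k > 0\<close> \<open>m j > 0\<close> by simp
  qed
  have rest: "\<bar>\<Sum>k\<in>{1..d}-{j}. real k * b k * exp (real k * t)\<bar> \<le> m j / 2"
  proof -
    have "\<bar>\<Sum>k\<in>{1..d}-{j}. real k * b k * exp (real k * t)\<bar> \<le> (\<Sum>k\<in>{1..d}-{j}. real k * m k)"
      by (rule order_trans[OF sum_abs]) (simp add: m_def abs_mult mult.assoc)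
    also have "\<dots> \<le> (\<Sum>k\<in>{1..d}-{j}. real d * (exp (- R) * m j))"
      using small m0 by (intro sum_mono mult_mono) auto
    also have "\<dots> \<le> (\<Sum>k\<in>{1..d}. real d * (exp (- R) * m j))"
      using m0 by (intro sum_mono2) auto
    also have "\<dots> = (2 * (real d)\<^sup>2 / exp R) * (m j / 2)"
      by (simp add: power2_eq_square exp_minus field_simps)
    also have "\<dots> \<le> 1 * (m j / 2)"
      using R m0[of j] by (intro mult_right_mono) auto
    finally show ?thesis by simp
  qed
  have "exp_sum d (\<lambda>k. real k * b k) t =
      real j * b j * exp (real j * t) + (\<Sum>k\<in>{1..d}-{j}. real k * b k * exp (real k * t))"
    unfolding exp_sum_def using j by (subst sum.remove[of _ j]) auto
  moreover have "m j \<le> \<bar>real j * b j * exp (real j * t)\<bar>"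
  proof -
    have "1 * m j \<le> real j * m j" using j m0 by (intro mult_right_mono) auto
    then show ?thesis by (simp add: m_def abs_mult mult.assoc)
  qed
  ultimately have "m j / 2 \<le> \<bar>exp_sum d (\<lambda>k. real k * b k) t\<bar>"
    using rest by linarith
  moreover have "exp_sum d (\<lambda>k. \<bar>b k\<bar>) t \<le> real d * m j"
    unfolding exp_sum_def using sum_bounded_above[of "{1..d}" m "m j"] max by (simp add: m_def)
  then have "1 / (2 * real d) * exp_sum d (\<lambda>k. \<bar>b k\<bar>) t \<le> 1 / (2 * real d) * (real d * m j)"
    by (intro mult_left_mono) auto
  then have "1 / (2 * real d) * exp_sum d (\<lambda>k. \<bar>b k\<bar>) t \<le> m j / 2"
    using \<open>d > 0\<close> by simp
  ultimately show ?thesis by linarith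
qed

text \<open>Induction on \<open>Z\<close>: a new point removes a middle piece of length at most
  \<open>2 * R\<close> and leaves two intervals that keep distance \<open>R\<close> from it. The
  bound solves the recursion \<open>X (n + 1) = 2 * X n + 2 * R\<close> with
  \<open>X 0 = M\<close>.\<close>

lemma abs_integral_le_avoiding_finite:
  fixes h :: "real \<Rightarrow> real"
  assumes "finite Z" and "u \<le> v" and "R \<ge> 0" and "M \<ge> 0"
    and cont: "continuous_on UNIV h" and h1: "\<And>t. \<bar>h t\<bar> \<le> 1"
    and "\<And>u' v'. u \<le> u' \<Longrightarrow> u' \<le> v' \<Longrightarrow> v' \<le> v \<Longrightarrow> (\<And>t z. t \<in> {u'..v'} \<Longrightarrow> z \<in> Z \<Longrightarrow> R \<le> \<bar>t - z\<bar>) \<Longrightarrow>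
      \<bar>integral {u'..v'} h\<bar> \<le> M"
  shows "\<bar>integral {u..v} h\<bar> \<le> 2 ^ card Z * (M + 2 * R) - 2 * R"
  using assms(1,2,7)
proof (induction Z arbitrary: u v rule: finite_induct)
  case empty
  then show ?case by simp
next
  case (insert z Z)
  have int: "h integrable_on {s..t}" for s t
    using cont by (intro integrable_continuous_interval) (auto intro: continuous_on_subset)
  \<comment> \<open>The ends \<open>z - R\<close> and \<open>z + R\<close> of the excluded
    neighbourhood are clamped to the interval, so a piece that lies outside degenerates to a
    point.\<close>
  define p where "p = max u (min v (z - R))"
  define q where "q = max u (min v (z + R))"
  have pq: "u \<le> p" "p \<le> q" "q \<le> v" "q - p \<le> 2 * R"
    using insert.prems(1) \<open>R \<ge> 0\<close> by (auto simp: p_def q_def)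
  define K where "K = 2 ^ card Z * (M + 2 * R) - 2 * R"
  \<comment> \<open>With \<open>M \<ge> 0\<close> this makes \<open>K\<close> nonnegative, which
    settles the degenerate pieces.\<close>
  have M_le_K: "M \<le> K"
  proof -
    have "1 * (M + 2 * R) \<le> 2 ^ card Z * (M + 2 * R)"
      using \<open>R \<ge> 0\<close> \<open>M \<ge> 0\<close> by (intro mult_right_mono) auto
    then show ?thesis by (simp add: K_def)
  qed
  have left: "\<bar>integral {u..p} h\<bar> \<le> K"
  proof (cases "p = u")
    case True
    then show ?thesis using M_le_K \<open>M \<ge> 0\<close> by simp
  next
    case False
    \<comment> \<open>A nondegenerate left piece ends no later than \<open>z - R\<close>, so its
      subintervals that avoid \<open>Z\<close> also avoid \<open>z\<close>.\<close>
    then have "p \<le> z - R" using insert.prems(1) by (auto simp: p_def max_def split: if_splits)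
    show ?thesis
      unfolding K_def
    proof (rule insert.IH[OF pq(1)])
      fix u' v' assume "u \<le> u'" "u' \<le> v'" "v' \<le> p"
        "\<And>t z'. t \<in> {u'..v'} \<Longrightarrow> z' \<in> Z \<Longrightarrow> R \<le> \<bar>t - z'\<bar>"
      then show "\<bar>integral {u'..v'} h\<bar> \<le> M"
        using \<open>p \<le> z - R\<close> pq by (intro insert.prems(2)) auto
    qed
  qed
  have right: "\<bar>integral {q..v} h\<bar> \<le> K"
  proof (cases "q = v")
    case True
    then show ?thesis using M_le_K \<open>M \<ge> 0\<close> by simp
  next
    case False
    then have "q \<ge> z + R" using insert.prems(1) by (auto simp: q_def max_def min_def split: if_splits)
    show ?thesis
      unfolding K_def
    proof (rule insert.IH[OF pq(3)])
      fix u' v' assume "q \<le> u'" "u' \<le> v'" "v' \<le> v"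
        "\<And>t z'. t \<in> {u'..v'} \<Longrightarrow> z' \<in> Z \<Longrightarrow> R \<le> \<bar>t - z'\<bar>"
      then show "\<bar>integral {u'..v'} h\<bar> \<le> M"
        using \<open>q \<ge> z + R\<close> pq by (intro insert.prems(2)) auto
    qed
  qed
  have "norm (integral {p..q} h) \<le> 1 * (q - p)"
    using h1 pq by (intro integral_bound) (auto intro: continuous_on_subset[OF cont])
  then have mid: "\<bar>integral {p..q} h\<bar> \<le> 2 * R" using pq by simp
  have "integral {u..v} h = integral {u..p} h + integral {p..q} h + integral {q..v} h"
    using Henstock_Kurzweil_Integration.integral_combine[OF _ pq(3) int, of u] Henstock_Kurzweil_Integration.integral_combine[OF pq(1,2) int] pq by simp
  then have "\<bar>integral {u..v} h\<bar> \<le> 2 * K + 2 * R"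
    using left mid right by linarith
  also have "\<dots> = 2 ^ card (insert z Z) * (M + 2 * R) - 2 * R"
    using insert.hyps by (simp add: K_def algebra_simps)
  finally show ?case .
qed

text \<open>The exceptional points move with \<open>b\<close>, but their number is at most
  \<open>d * d\<close>; this makes \<open>C\<close> uniform in the coefficients.\<close>

lemma integral_cos_exp_sum_bounded:
  assumes "d > 0" "\<delta> > 0"
  shows "\<exists>C. \<forall>b \<theta> u v. u \<le> v \<longrightarrow> \<delta> \<le> exp_sum d (\<lambda>k. \<bar>b k\<bar>) u \<longrightarrow>
    \<bar>integral {u..v} (\<lambda>t. cos (\<theta> + exp_sum d b t))\<bar> \<le> C"
proof -
  define R where "R = ln (2 * (real d)\<^sup>2)"
  define \<kappa> where "\<kappa> = 1 / (2 * real d)"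
  define M where "M = 2 / (\<kappa> * \<delta>) + (real d)\<^sup>2 / (\<kappa>\<^sup>2 * \<delta>)"
  have d1: "1 \<le> (real d)\<^sup>2" using \<open>d > 0\<close> by (simp add: one_le_power)
  have R: "2 * (real d)\<^sup>2 \<le> exp R"
    using \<open>d > 0\<close> by (simp add: R_def)
  have R0: "R \<ge> 0"
    unfolding R_def using d1 by (intro ln_ge_zero) linarith
  have \<kappa>: "\<kappa> > 0" using \<open>d > 0\<close> by (simp add: \<kappa>_def)
  have M: "M \<ge> 0" using \<open>\<delta> > 0\<close> \<kappa> by (simp add: M_def)
  have "\<bar>integral {u..v} (\<lambda>t. cos (\<theta> + exp_sum d b t))\<bar> \<le> 2 ^ (d * d) * (M + 2 * R)"
    if uv: "u \<le> v" and start: "\<delta> \<le> exp_sum d (\<lambda>k. \<bar>b k\<bar>) u" for b \<theta> u v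
  proof -
    \<comment> \<open>The diagonal pairs \<open>j = k\<close> contribute \<open>x / 0 = 0\<close>.
      Such points and those from zero coefficients mark no crossing; avoiding them as well is
      harmless.\<close>
    define Z where "Z = (\<lambda>(j, k). (ln \<bar>b j\<bar> - ln \<bar>b k\<bar>) / (real k - real j)) ` ({1..d} \<times> {1..d})"
    have Z: "finite Z" "card Z \<le> d * d"
      unfolding Z_def using card_image_le[of "{1..d} \<times> {1..d}"]
      by (auto simp: card_cartesian_product)
    have "\<bar>integral {u..v} (\<lambda>t. cos (\<theta> + exp_sum d b t))\<bar> \<le> 2 ^ card Z * (M + 2 * R) - 2 * R"
    proof (rule abs_integral_le_avoiding_finite[OF Z(1) uv R0 M])
      show "continuous_on UNIV (\<lambda>t. cos (\<theta> + exp_sum d b t))"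
        by (intro continuous_intros)
      fix u' v' assume *: "u \<le> u'" "u' \<le> v'" "v' \<le> v"
        and far: "\<And>t z. t \<in> {u'..v'} \<Longrightarrow> z \<in> Z \<Longrightarrow> R \<le> \<bar>t - z\<bar>"
      show "\<bar>integral {u'..v'} (\<lambda>t. cos (\<theta> + exp_sum d b t))\<bar> \<le> M"
        unfolding M_def
      proof (rule integral_cos_exp_sum_le[OF *(2) \<open>\<delta> > 0\<close> \<kappa>])
        show "\<delta> \<le> exp_sum d (\<lambda>k. \<bar>b k\<bar>) u'"
          using exp_sum_mono[of "\<lambda>k. \<bar>b k\<bar>" u u' d] start *(1) by simp
        fix t assume t: "t \<in> {u'..v'}"
        show "\<kappa> * exp_sum d (\<lambda>k. \<bar>b k\<bar>) t \<le> \<bar>exp_sum d (\<lambda>k. real k * b k) t\<bar>"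
          unfolding \<kappa>_def by (rule exp_sum_dominant[OF R \<open>d > 0\<close>], rule far[OF t]) (force simp: Z_def)
      qed
    qed auto
    also have "\<dots> \<le> 2 ^ card Z * (M + 2 * R)"
      using R0 by simp
    also have "\<dots> \<le> 2 ^ (d * d) * (M + 2 * R)"
      using Z R0 M by (intro mult_right_mono power_increasing) auto
    finally show ?thesis .
  qed
  then show ?thesis by blast
qed

section \<open>One-sided bound for arbitrary coefficients\<close>

text \<open>\<open>B\<close> is increasing, so one point at most separates the range where the
  cosine is nonnegative from the range where its integral is bounded. No such upper bound can hold:
  for \<open>b = 0\<close> and \<open>\<theta> = 0\<close> the integral is
  \<open>v - u\<close>.\<close>

lemma integral_cos_exp_sum_lower_bound:
  assumes "d > 0" "K \<ge> 0"
  shows "\<exists>C. \<forall>b \<theta> u v. 0 \<le> u \<longrightarrow> u \<le> v \<longrightarrow> \<bar>\<theta>\<bar> \<le> K * (\<Sum>k=1..d. \<bar>b k\<bar>) \<longrightarrow>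
    - C \<le> integral {u..v} (\<lambda>t. cos (\<theta> + exp_sum d b t))"
proof -
  \<comment> \<open>The phase is at most \<open>(K + 1) * B t\<close> in modulus, so
    \<open>B t \<le> \<delta>\<close> keeps it below 1 and hence below
    \<open>pi / 2\<close>.\<close>
  define \<delta> where "\<delta> = 1 / (K + 1)"
  have \<delta>: "\<delta> > 0" using \<open>K \<ge> 0\<close> by (simp add: \<delta>_def)
  obtain C where C: "\<And>b \<theta> u v. u \<le> v \<Longrightarrow> \<delta> \<le> exp_sum d (\<lambda>k. \<bar>b k\<bar>) u \<Longrightarrow>
    \<bar>integral {u..v} (\<lambda>t. cos (\<theta> + exp_sum d b t))\<bar> \<le> C"
    using integral_cos_exp_sum_bounded[OF \<open>d > 0\<close> \<delta>] by blast
  have "- max C 0 \<le> integral {u..v} (\<lambda>t. cos (\<theta> + exp_sum d b t))"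
    if u: "0 \<le> u" and uv: "u \<le> v" and \<theta>: "\<bar>\<theta>\<bar> \<le> K * (\<Sum>k=1..d. \<bar>b k\<bar>)" for b \<theta> u v
  proof -
    define B where "B = exp_sum d (\<lambda>k. \<bar>b k\<bar>)"
    define h where "h t = cos (\<theta> + exp_sum d b t)" for t
    have int: "h integrable_on {s..t}" for s t
      unfolding h_def by (intro integrable_continuous_interval continuous_intros)
    have h_nonneg: "h t \<ge> 0" if t: "t \<ge> 0" and Bt: "B t \<le> \<delta>" for t
    proof -
      \<comment> \<open>The left side is \<open>B 0\<close>, so the bound on \<open>\<theta>\<close>
        becomes one in terms of \<open>B t\<close>.\<close>
      have "(\<Sum>k=1..d. \<bar>b k\<bar>) \<le> B t"
        using exp_sum_mono[of "\<lambda>k. \<bar>b k\<bar>" 0 t d] t by (simp add: B_def exp_sum_def)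
      then have "\<bar>\<theta>\<bar> \<le> K * B t"
        using \<theta> \<open>K \<ge> 0\<close> by (meson mult_left_mono order_trans)
      moreover have "\<bar>exp_sum d b t\<bar> \<le> B t"
        using abs_exp_sum_le[of d b 1 b t] by (simp add: B_def)
      ultimately have "\<bar>\<theta> + exp_sum d b t\<bar> \<le> (K + 1) * B t"
        by (simp add: algebra_simps)
      also have "\<dots> \<le> (K + 1) * \<delta>"
        using Bt \<open>K \<ge> 0\<close> by (intro mult_left_mono) auto
      also have "\<dots> \<le> pi / 2"
        using \<open>K \<ge> 0\<close> pi_gt3 by (simp add: \<delta>_def)
      finally have "\<bar>\<theta> + exp_sum d b t\<bar> \<le> pi / 2" .
      then show ?thesis
        unfolding h_def by (intro cos_ge_zero) linarith+
    qed
    have nonneg: "integral {u..s} h \<ge> 0" if "B s \<le> \<delta>" for s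
    proof (rule integral_nonneg[OF int])
      fix t assume t: "t \<in> {u..s}"
      then have "B t \<le> B s" unfolding B_def by (intro exp_sum_mono) auto
      with that t u show "h t \<ge> 0" by (intro h_nonneg) auto
    qed
    show ?thesis
    proof (cases "B u \<le> \<delta> \<and> \<delta> \<le> B v")
      case True
      have "continuous_on {u..v} B" unfolding B_def by (intro continuous_intros)
      then obtain s where s: "u \<le> s" "s \<le> v" "B s = \<delta>"
        using IVT'[of B u \<delta> v] True uv by auto
      have "integral {u..v} h = integral {u..s} h + integral {s..v} h"
        using Henstock_Kurzweil_Integration.integral_combine[OF s(1,2) int] by simp
      moreover have "\<bar>integral {s..v} h\<bar> \<le> C"
        unfolding h_def using s by (intro C) (auto simp: B_def)
      moreover have "integral {u..s} h \<ge> 0" using s by (intro nonneg) auto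
      ultimately show ?thesis unfolding h_def by linarith
    next
      case False
      then consider "\<delta> \<le> B u" | "B v \<le> \<delta>" by linarith
      then show ?thesis
      proof cases
        case 1
        then have "\<bar>integral {u..v} h\<bar> \<le> C"
          unfolding h_def using uv by (intro C) (auto simp: B_def)
        then show ?thesis unfolding h_def by linarith
      next
        case 2
        then show ?thesis using nonneg[of v] unfolding h_def by simp
      qed
    qed
  qed
  then show ?thesis by blast
qed

section \<open>Linear independence and the constant term\<close>

text \<open>A combination of degree 0 is a constant, and subtracting that multiple of 1 gives a
  linear relation.\<close>

lemma one_and_lin_indep_imp_eq_zero:
  assumes "one_and_lin_indep f" and "degree (\<Sum>i\<in>UNIV. smult (c i) (f i)) = 0"
  shows "c i = 0"
proof -
  define p where "p = (\<Sum>i\<in>UNIV. smult (c i) (f i))"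
  obtain e where "p = [:e:]"
    using assms(2) degree_eq_zeroE unfolding p_def by blast
  then have "smult (- e) 1 + p = 0" by simp
  then show ?thesis
    using assms(1) unfolding one_and_lin_indep_iff p_def by blast
qed

text \<open>Compactness: \<open>N\<close> is continuous, homogeneous and, by independence, positive
  away from 0. It therefore dominates a multiple of the Euclidean norm, while the constant
  coefficient is linear in \<open>l\<close>.\<close>

lemma abs_constant_coeff_le:
  fixes f :: "'m::finite \<Rightarrow> real poly"
  assumes indep: "one_and_lin_indep f" and d: "\<And>i. degree (f i) \<le> d"
  shows "\<exists>K\<ge>0. \<forall>l :: real ^ 'm.
    \<bar>coeff (\<Sum>i\<in>UNIV. smult (l $ i) (f i)) 0\<bar> \<le> K * (\<Sum>k=1..d. \<bar>coeff (\<Sum>i\<in>UNIV. smult (l $ i) (f i)) k\<bar>)"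
proof -
  define p where "p l = (\<Sum>i\<in>UNIV. smult (l $ i) (f i))" for l :: "real ^ 'm"
  define N where "N l = (\<Sum>k=1..d. \<bar>coeff (p l) k\<bar>)" for l
  have coeff_p: "coeff (p l) k = (\<Sum>i\<in>UNIV. l $ i * coeff (f i) k)" for l k
    by (simp add: p_def coeff_sum)
  have N_pos: "N l > 0" if "l \<noteq> 0" for l
  proof (rule ccontr)
    assume "\<not> N l > 0"
    moreover have "N l \<ge> 0" by (simp add: N_def sum_nonneg)
    ultimately have "N l = 0" by simp
    then have *: "coeff (p l) k = 0" if "k \<in> {1..d}" for k
      using that unfolding N_def by (subst (asm) sum_nonneg_eq_0_iff) auto
    have "coeff (p l) k = 0" if "k > 0" for k
    proof (cases "k \<le> d")
      case True
      then show ?thesis using * that by simp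
    next
      case False
      then have "coeff (f i) k = 0" for i
        using d[of i] by (intro coeff_eq_0) linarith
      then show ?thesis by (simp add: coeff_p)
    qed
    \<comment> \<open>All coefficients of positive index vanish, so independence forces
      \<open>l = 0\<close>.\<close>
    then have "degree (p l) = 0"
      using degree_le[of 0 "p l"] by simp
    then have "l $ i = 0" for i
      using one_and_lin_indep_imp_eq_zero[OF indep, of "\<lambda>i. l $ i"] by (simp add: p_def)
    then show False using that by (simp add: vec_eq_iff)
  qed
  have "continuous_on (sphere 0 1) N"
    unfolding N_def coeff_p by (intro continuous_intros)
  moreover have "sphere (0 :: real ^ 'm) 1 \<noteq> {}" by simp
  ultimately obtain l0 where l0: "l0 \<in> sphere 0 1" "\<And>l. l \<in> sphere 0 1 \<Longrightarrow> N l0 \<le> N l"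
    using continuous_attains_inf[of "sphere (0 :: real ^ 'm) 1" N] compact_sphere by blast
  define \<mu> where "\<mu> = N l0"
  have \<mu>: "\<mu> > 0" unfolding \<mu>_def using l0(1) by (intro N_pos) auto
  have N_scale: "N (r *\<^sub>R l) = \<bar>r\<bar> * N l" for r l
    by (simp add: N_def coeff_p sum_distrib_left mult.assoc abs_mult flip: sum_distrib_left)
  have N_ge: "\<mu> * norm l \<le> N l" for l
  proof (cases "l = 0")
    case False
    then have "\<mu> \<le> N ((1 / norm l) *\<^sub>R l)"
      unfolding \<mu>_def by (intro l0(2)) simp
    then show ?thesis using False by (simp add: N_scale field_simps)
  qed (simp add: N_def sum_nonneg)
  define A where "A = (\<Sum>i\<in>UNIV. \<bar>coeff (f i) 0\<bar>)"
  have A: "A \<ge> 0" by (simp add: A_def sum_nonneg)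
  have "\<bar>coeff (p l) 0\<bar> \<le> A / \<mu> * N l" for l
  proof -
    have "\<bar>coeff (p l) 0\<bar> \<le> (\<Sum>i\<in>UNIV. norm l * \<bar>coeff (f i) 0\<bar>)"
      unfolding coeff_p
      by (rule order_trans[OF sum_abs])
         (auto simp: abs_mult intro!: sum_mono mult_right_mono component_le_norm_cart)
    also have "\<dots> = A / \<mu> * (\<mu> * norm l)"
      using \<mu> by (simp add: A_def sum_distrib_left[symmetric])
    also have "\<dots> \<le> A / \<mu> * N l"
      using A \<mu> by (intro mult_left_mono N_ge) auto
    finally show ?thesis .
  qed
  then show ?thesis
    using A \<mu> unfolding N_def p_def by (intro exI[of _ "A / \<mu>"]) auto
qed

text \<open>This places the interval of integration in \<open>t \<ge> 0\<close>, as the lower bound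
  for exponential sums requires.\<close>

lemma last_log_zero_nonneg:
  assumes "one_and_lin_indep f"
  shows "last_log_zero f \<ge> 0"
proof (cases "common_log_zeros f = {}")
  case False
  then have "Max (common_log_zeros f) \<in> common_log_zeros f"
    using finite_common_log_zeros[OF assms] by (rule Max_in[rotated])
  then show ?thesis using False by (auto simp: last_log_zero_def common_log_zeros_def)
qed (simp add: last_log_zero_def)

section \<open>The Fourier transform of the curve measure\<close>

text \<open>Both summands of the symmetric measure are carried by one density on the real line, the negative
  half-line accounting for the points of the curve in \<open>-E\<close>.\<close>

definition reflected_density :: "real \<Rightarrow> real \<Rightarrow> real \<Rightarrow> real" where
  "reflected_density a T s = indicator {exp a..exp T} \<bar>s\<bar> / (2 * (T - a) * \<bar>s\<bar>)"

text \<open>A push-forward of a density allows integrals to be computed by change of variables. On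
  each Borel set the two half-lines give the two indicators in the definition of the
  measure.\<close>

lemma curve_measure_eq_distr:
  fixes F :: "real \<Rightarrow> real ^ 'm::finite"
  assumes F [measurable]: "F \<in> borel_measurable borel" and aT: "a < T"
  shows "curve_measure F a T =
    distr (density lborel (reflected_density a T)) borel (\<lambda>s. if 0 < s then F s else - F (- s))"
    (is "_ = distr ?N borel ?G")
proof (rule measure_eqI)
  fix E assume "E \<in> sets (curve_measure F a T)"
  then have E [measurable]: "E \<in> sets borel" by simp
  have [measurable]: "reflected_density a T \<in> borel_measurable borel"
    unfolding reflected_density_def by measurable
  define k where "k s = ennreal (reflected_density a T s) * indicator E (?G s)" for s
  have [measurable]: "k \<in> borel_measurable borel"
    unfolding k_def by measurable
  \<comment> \<open>As the density vanishes at 0, the splitting into open half-lines is exact at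
    every point.\<close>
  have zero: "k 0 = 0"
    by (simp add: k_def reflected_density_def)
  have "emeasure (distr ?N borel ?G) E = emeasure ?N (?G -` E)"
    by (subst emeasure_distr) auto
  also have "\<dots> = (\<integral>\<^sup>+s. ennreal (reflected_density a T s) * indicator (?G -` E) s \<partial>lborel)"
  proof (rule emeasure_density)
    have "?G -` E \<inter> space borel \<in> sets borel" by measurable
    then show "?G -` E \<in> sets lborel" by simp
  qed simp
  also have "\<dots> = (\<integral>\<^sup>+s. k s \<partial>lborel)"
    by (intro nn_integral_cong) (simp add: k_def indicator_def)
  also have "\<dots> = (\<integral>\<^sup>+s. k s * indicator {0<..} s + k s * indicator {..<0} s \<partial>lborel)"
  proof (rule nn_integral_cong)
    fix s :: real
    show "k s = k s * indicator {0<..} s + k s * indicator {..<0} s"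
      by (cases s "0 :: real" rule: linorder_cases) (simp_all add: zero)
  qed
  also have "\<dots> = (\<integral>\<^sup>+s. k s * indicator {0<..} s \<partial>lborel) + (\<integral>\<^sup>+s. k s * indicator {..<0} s \<partial>lborel)"
    by (rule nn_integral_add) measurable
  also have "(\<integral>\<^sup>+s. k s * indicator {..<0} s \<partial>lborel) = (\<integral>\<^sup>+s. k (- s) * indicator {0<..} s \<partial>lborel)"
    by (subst nn_integral_real_affine[where c = "-1" and t = 0]) (auto simp: indicator_def intro!: nn_integral_cong)
  also have "(\<integral>\<^sup>+s. k s * indicator {0<..} s \<partial>lborel) + (\<integral>\<^sup>+s. k (- s) * indicator {0<..} s \<partial>lborel) =
      (\<integral>\<^sup>+s. k s * indicator {0<..} s + k (- s) * indicator {0<..} s \<partial>lborel)"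
    by (rule nn_integral_add[symmetric]) measurable
  also have "\<dots> = (\<integral>\<^sup>+s. ennreal (1 / (2 * (T - a))) *
      (ennreal ((indicator E (F s) + indicator (uminus ` E) (F s)) / s) * indicator {exp a..exp T} s) \<partial>lborel)"
  proof (rule nn_integral_cong)
    fix s :: real
    have neg: "x \<in> uminus ` E \<longleftrightarrow> - x \<in> E" for x :: "real ^ 'm"
      by (metis image_iff minus_minus)
    have "s > 0" if "exp a \<le> s" using that exp_gt_zero[of a] by linarith
    then show "k s * indicator {0<..} s + k (- s) * indicator {0<..} s = ennreal (1 / (2 * (T - a))) *
      (ennreal ((indicator E (F s) + indicator (uminus ` E) (F s)) / s) * indicator {exp a..exp T} s)"
      using aT by (auto simp: k_def reflected_density_def indicator_def neg ennreal_mult[symmetric]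
          simp flip: ennreal_plus)
  qed
  also have "\<dots> = emeasure (curve_measure F a T) E"
  proof -
    have m: "(\<lambda>s. ennreal ((indicator E (F s) + indicator (uminus ` E) (F s)) / s) * indicator {exp a..exp T} s)
        \<in> borel_measurable lborel"
    proof -
      \<comment> \<open>Negation is an involution, so the image is a preimage and hence
        Borel.\<close>
      have "uminus ` E = uminus -` E \<inter> space borel"
        by force
      also have "\<dots> \<in> sets borel" by measurable
      finally have [measurable]: "uminus ` E \<in> sets borel" .
      show ?thesis by measurable
    qed
    show ?thesis by (simp add: emeasure_curve_measure nn_integral_cmult[OF m])
  qed
  finally show "emeasure (curve_measure F a T) E = emeasure (distr ?N borel ?G) E" ..
qed simp

text \<open>The reflected half contributes the complex conjugate of the other half, so only a cosine
  remains; then \<open>s = exp t\<close> turns \<open>ds / s\<close> into \<open>dt\<close>.\<close>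

lemma fourier_transform_curve_measure:
  fixes F :: "real \<Rightarrow> real ^ 'm::finite"
  assumes F: "continuous_on UNIV F" and aT: "a < T"
  shows "fourier_transform (curve_measure F a T) l =
    complex_of_real (1 / (T - a) * integral {a..T} (\<lambda>t. cos (2 * pi * (F (exp t) \<bullet> l))))"
proof -
  have [measurable]: "F \<in> borel_measurable borel"
    using F by (rule borel_measurable_continuous_onI)
  have [measurable]: "reflected_density a T \<in> borel_measurable borel"
    unfolding reflected_density_def by measurable
  define G where "G s = (if 0 < s then F s else - F (- s))" for s
  have [measurable]: "G \<in> borel_measurable borel"
    unfolding G_def by measurable
  define e where "e x = exp (- 2 * of_real pi * \<i> * of_real (x \<bullet> l))" for x :: "real ^ 'm"
  have [measurable]: "e \<in> borel_measurable borel"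
    unfolding e_def by measurable
  define I where "I = {exp a..exp T}"
  have pos: "s > 0" if "s \<in> I" for s
    using that less_le_trans[OF exp_gt_zero[of a]] unfolding I_def by simp
  define w where "w s = 1 / (2 * (T - a) * s)" for s
  \<comment> \<open>\<open>r = 1\<close> covers the curve and \<open>r = -1\<close> its
    reflection.\<close>
  have int_I: "set_integrable lborel I (\<lambda>s. w s *\<^sub>R e (r *\<^sub>R F s))" for r
    unfolding I_def set_integrable_def
  proof (rule borel_integrable_compact)
    show "continuous_on {exp a..exp T} (\<lambda>s. w s *\<^sub>R e (r *\<^sub>R F s))"
      unfolding w_def e_def using aT pos
      by (intro continuous_intros continuous_on_subset[OF F]) (force simp: I_def)+
  qed simp
  define k where "k s = reflected_density a T s *\<^sub>R e (G s)" for s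
  have k1: "indicator {0<..} s *\<^sub>R k s = indicator I s *\<^sub>R (w s *\<^sub>R e (1 *\<^sub>R F s))" for s
    using pos[of s] by (auto simp: k_def reflected_density_def G_def w_def indicator_def I_def)
  have k2: "indicator {0<..} s *\<^sub>R k (- s) = indicator I s *\<^sub>R (w s *\<^sub>R e ((-1) *\<^sub>R F s))" for s
    using pos[of s] by (auto simp: k_def reflected_density_def G_def w_def indicator_def I_def)
  have int1: "integrable lborel (\<lambda>s. indicator {0<..} s *\<^sub>R k s)"
    unfolding k1 using int_I[of 1] by (simp add: set_integrable_def)
  have int2: "integrable lborel (\<lambda>s. indicator {0<..} s *\<^sub>R k (- s))"
    unfolding k2 using int_I[of "-1"] by (simp add: set_integrable_def)
  \<comment> \<open>The unsimplified \<open>0 + (-1) * s\<close> matches the affine substitution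
    rules for \<open>lborel\<close>.\<close>
  have reflect: "(\<lambda>s. indicator {0<..} (0 + (-1) * s) *\<^sub>R k (- (0 + (-1) * s))) = (\<lambda>s. indicator {..<0} s *\<^sub>R k s)"
    by (auto simp: indicator_def)
  have int3: "integrable lborel (\<lambda>s. indicator {..<0} s *\<^sub>R k s)"
    using lborel_integrable_real_affine[OF int2, of "-1" 0] unfolding reflect by simp
  have "fourier_transform (curve_measure F a T) l = (LINT x|distr (density lborel (reflected_density a T)) borel G. e x)"
    using aT unfolding fourier_transform_def e_def G_def by (subst curve_measure_eq_distr) simp_all
  also have "\<dots> = (LINT s|density lborel (reflected_density a T). e (G s))"
    by (rule integral_distr) auto
  also have "\<dots> = (LINT s|lborel. k s)"
    unfolding k_def using aT by (subst integral_density) (auto simp: reflected_density_def)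
  also have "\<dots> = (LINT s|lborel. indicator {0<..} s *\<^sub>R k s + indicator {..<0} s *\<^sub>R k s)"
  proof (rule Bochner_Integration.integral_cong[OF refl])
    fix s :: real
    have "k 0 = 0" by (simp add: k_def reflected_density_def)
    then show "k s = indicator {0<..} s *\<^sub>R k s + indicator {..<0} s *\<^sub>R k s"
      by (cases s "0 :: real" rule: linorder_cases) auto
  qed
  also have "\<dots> = (LINT s|lborel. indicator {0<..} s *\<^sub>R k s) + (LINT s|lborel. indicator {..<0} s *\<^sub>R k s)"
    using int1 int3 by (rule Bochner_Integration.integral_add)
  also have "(LINT s|lborel. indicator {..<0} s *\<^sub>R k s) = (LINT s|lborel. indicator {0<..} s *\<^sub>R k (- s))"
    using lborel_integral_real_affine[of "-1" "\<lambda>s. indicator {0<..} s *\<^sub>R k (- s)" 0] unfolding reflect by simp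
  also have "(LINT s|lborel. indicator {0<..} s *\<^sub>R k s) + \<dots> =
      (LINT s|lborel. indicator {0<..} s *\<^sub>R k s + indicator {0<..} s *\<^sub>R k (- s))"
    using int1 int2 by (rule Bochner_Integration.integral_add[symmetric])
  also have "\<dots> = (LINT s|lborel. complex_of_real (indicator I s *\<^sub>R (cos (2 * pi * (F s \<bullet> l)) / ((T - a) * s))))"
  proof (rule Bochner_Integration.integral_cong[OF refl])
    fix s :: real
    have "e (1 *\<^sub>R F s) + e ((-1) *\<^sub>R F s) = complex_of_real (2 * cos (2 * pi * (F s \<bullet> l)))"
    proof -
      have cis: "e (r *\<^sub>R F s) = cis (- (2 * pi * (r * (F s \<bullet> l))))" for r
        by (simp add: e_def cis_conv_exp mult_ac)
      show ?thesis unfolding cis by (simp add: complex_eq_iff)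
    qed
    then have "w s *\<^sub>R e (1 *\<^sub>R F s) + w s *\<^sub>R e ((-1) *\<^sub>R F s) =
        complex_of_real (w s * (2 * cos (2 * pi * (F s \<bullet> l))))"
      by (simp add: scaleR_conv_of_real flip: distrib_left)
    \<comment> \<open>Keeping \<open>2 * (T - a)\<close> unexpanded lets the 2 of the cosine cancel
      the 2 of the symmetrization.\<close>
    also have "w s * (2 * cos (2 * pi * (F s \<bullet> l))) = cos (2 * pi * (F s \<bullet> l)) / ((T - a) * s)"
      by (simp add: w_def mult.assoc del: right_diff_distrib_numeral)
    finally show "indicator {0<..} s *\<^sub>R k s + indicator {0<..} s *\<^sub>R k (- s) =
        complex_of_real (indicator I s *\<^sub>R (cos (2 * pi * (F s \<bullet> l)) / ((T - a) * s)))"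
      unfolding k1 k2 by (simp add: indicator_def)
  qed
  also have "\<dots> = complex_of_real (LINT s:I|lborel. cos (2 * pi * (F s \<bullet> l)) / ((T - a) * s))"
    unfolding set_lebesgue_integral_def by (rule integral_complex_of_real)
  also have "(LINT s:I|lborel. cos (2 * pi * (F s \<bullet> l)) / ((T - a) * s)) =
      integral I (\<lambda>s. cos (2 * pi * (F s \<bullet> l)) / ((T - a) * s))"
  proof (rule set_borel_integral_eq_integral)
    show "set_integrable lborel I (\<lambda>s. cos (2 * pi * (F s \<bullet> l)) / ((T - a) * s))"
      unfolding I_def set_integrable_def
    proof (rule borel_integrable_compact)
      show "continuous_on {exp a..exp T} (\<lambda>s. cos (2 * pi * (F s \<bullet> l)) / ((T - a) * s))"
        using aT pos by (intro continuous_intros continuous_on_subset[OF F]) (force simp: I_def)+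
    qed simp
  qed
  also have "\<dots> = integral {a..T} (\<lambda>t. exp t *\<^sub>R (cos (2 * pi * (F (exp t) \<bullet> l)) / ((T - a) * exp t)))"
  proof (rule integral_unique[symmetric], unfold I_def, rule has_integral_substitution)
    show "continuous_on {exp a..exp T} (\<lambda>s. cos (2 * pi * (F s \<bullet> l)) / ((T - a) * s))"
      using aT pos by (intro continuous_intros continuous_on_subset[OF F]) (force simp: I_def)+
  qed (use aT in \<open>auto intro!: derivative_eq_intros\<close>)
  also have "\<dots> = integral {a..T} (\<lambda>t. 1 / (T - a) * cos (2 * pi * (F (exp t) \<bullet> l)))"
    by simp
  finally show ?thesis by simp
qed

section \<open>The lower bound\<close>

text \<open>Brings the phase into the shape \<open>\<theta> + exp_sum d b t\<close>, with
  \<open>\<theta>\<close> from the coefficient of index 0.\<close>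

lemma phase_eq_exp_sum:
  assumes "\<And>i. degree (f i) \<le> d"
  shows "2 * pi * (\<Sum>i\<in>UNIV. l $ i * poly (f i) (exp t)) =
    2 * pi * coeff (\<Sum>i\<in>UNIV. smult (l $ i) (f i)) 0 +
    exp_sum d (\<lambda>k. 2 * pi * coeff (\<Sum>i\<in>UNIV. smult (l $ i) (f i)) k) t"
proof -
  define p where "p = (\<Sum>i\<in>UNIV. smult (l $ i) (f i))"
  have "degree p \<le> d"
    unfolding p_def using assms by (intro degree_sum_le) (auto intro: order_trans[OF degree_smult_le])
  have "(\<Sum>i\<in>UNIV. l $ i * poly (f i) (exp t)) = poly p (exp t)"
    by (simp add: p_def poly_sum)
  also have "\<dots> = (\<Sum>k\<le>d. coeff p k * exp t ^ k)"
    by (subst poly_as_sum_of_monoms'[OF \<open>degree p \<le> d\<close>, symmetric]) (simp add: poly_sum poly_monom)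
  also have "\<dots> = coeff p 0 + (\<Sum>k=1..d. coeff p k * exp (real k * t))"
    by (simp add: atMost_atLeast0 sum.atLeast_Suc_atMost exp_of_nat_mult)
  finally show ?thesis
    by (simp add: p_def exp_sum_def sum_distrib_left distrib_left mult.assoc)
qed

theorem theorem3p1:
  fixes f :: "'m::finite \<Rightarrow> real poly"
  assumes "CARD('m) \<ge> 2"
    and "one_and_lin_indep f"
  shows "\<exists>C>0. \<forall>a > last_log_zero f. \<forall>l :: real ^ 'm. \<forall>T > a.
    - C / (T - a) \<le> 1 / (T - a) *
        integral {a..T} (\<lambda>t. cos (2 * pi * (\<Sum>i\<in>UNIV. l $ i * poly (f i) (exp t)))) \<and>
    fourier_transform (curve_measure (poly_curve f) a T) l =
      complex_of_real (1 / (T - a) *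
        integral {a..T} (\<lambda>t. cos (2 * pi * (\<Sum>i\<in>UNIV. l $ i * poly (f i) (exp t)))))"
proof -
  \<comment> \<open>The sum bounds every single degree, and \<open>Suc\<close> gives
    \<open>d > 0\<close>.\<close>
  define d where "d = Suc (\<Sum>i\<in>UNIV. degree (f i))"
  have deg: "degree (f i) \<le> d" for i
    using member_le_sum[of i UNIV "\<lambda>i. degree (f i)"] by (simp add: d_def)
  have "d > 0" by (simp add: d_def)
  define p where "p l = (\<Sum>i\<in>UNIV. smult (l $ i) (f i))" for l :: "real ^ 'm"
  obtain K where K: "K \<ge> 0" "\<And>l. \<bar>coeff (p l) 0\<bar> \<le> K * (\<Sum>k=1..d. \<bar>coeff (p l) k\<bar>)"
    using abs_constant_coeff_le[OF assms(2) deg] unfolding p_def by blast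
  obtain C where C: "\<And>b \<theta> u v. 0 \<le> u \<Longrightarrow> u \<le> v \<Longrightarrow> \<bar>\<theta>\<bar> \<le> K * (\<Sum>k=1..d. \<bar>b k\<bar>) \<Longrightarrow>
    - C \<le> integral {u..v} (\<lambda>t. cos (\<theta> + exp_sum d b t))"
    using integral_cos_exp_sum_lower_bound[OF \<open>d > 0\<close> K(1)] by blast
  \<comment> \<open>\<open>C\<close> comes without a sign; \<open>max C 1\<close> is positive and
    only weakens the bound.\<close>
  have lower: "- max C 1 / (T - a) \<le> 1 / (T - a) *
      integral {a..T} (\<lambda>t. cos (2 * pi * (\<Sum>i\<in>UNIV. l $ i * poly (f i) (exp t))))"
    if a: "a > last_log_zero f" and T: "T > a" for a T and l :: "real ^ 'm"
  proof -
    \<comment> \<open>The coefficient bound is homogeneous, so the factor \<open>2 * pi\<close>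
      passes through with the same \<open>K\<close>.\<close>
    have "\<bar>2 * pi * coeff (p l) 0\<bar> \<le> K * (\<Sum>k=1..d. \<bar>2 * pi * coeff (p l) k\<bar>)"
      using K(2)[of l] by (simp add: abs_mult mult.assoc mult.left_commute[of K] flip: sum_distrib_left)
    then have "- C \<le> integral {a..T}
        (\<lambda>t. cos (2 * pi * coeff (p l) 0 + exp_sum d (\<lambda>k. 2 * pi * coeff (p l) k) t))"
      using a T last_log_zero_nonneg[OF assms(2)] by (intro C) auto
    then have "- max C 1 \<le> integral {a..T}
        (\<lambda>t. cos (2 * pi * (\<Sum>i\<in>UNIV. l $ i * poly (f i) (exp t))))"
      unfolding phase_eq_exp_sum[OF deg] p_def by linarith
    then have "- max C 1 / (T - a) \<le> integral {a..T}
        (\<lambda>t. cos (2 * pi * (\<Sum>i\<in>UNIV. l $ i * poly (f i) (exp t)))) / (T - a)"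
      using T by (intro divide_right_mono) auto
    then show ?thesis by simp
  qed
  have "continuous_on UNIV (poly_curve f)"
    unfolding poly_curve_def by (intro continuous_intros)
  moreover have "poly_curve f s \<bullet> l = (\<Sum>i\<in>UNIV. l $ i * poly (f i) s)" for s and l :: "real ^ 'm"
    by (simp add: poly_curve_def inner_vec_def mult.commute)
  ultimately have fourier: "fourier_transform (curve_measure (poly_curve f) a T) l =
      complex_of_real (1 / (T - a) *
        integral {a..T} (\<lambda>t. cos (2 * pi * (\<Sum>i\<in>UNIV. l $ i * poly (f i) (exp t)))))"
    if "T > a" for a T and l :: "real ^ 'm"
    using fourier_transform_curve_measure[of "poly_curve f" a T l] that by simp
  show ?thesis
    by (rule exI[of _ "max C 1"]) (intro conjI allI impI lower fourier; simp)
qed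

end
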